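(* Let $d$ be a positive integer and let $f : H_d \to [0, \infty)$ be a function such that for any $\boldsymbol{u}, \boldsymbol{v} \in H_d$ satisfying $(\boldsymbol{u}+\boldsymbol{v})/2 \in H_d$, we have \[ f\big( (\boldsymbol{u}+\boldsymbol{v})/2 \big) \leq \frac{f(\boldsymbol{u}) + f(\boldsymbol{v})}{2}. \] Then for any $\boldsymbol{u} = (u_1, \dots, u_d) \in H_d$, we have \[ f(\boldsymbol{u}) \leq \frac{1}{d} \sum_{i=1}^d u_i f(d \boldsymbol{e}_i). \]
   Context: For a positive integer $d$, \[ H_d = \{ (a_1, \dots, a_d) \in \mathbb{Z}^d : a_1, \dots, a_d \geq 0 \ \text{and} \ a_1 + \dots + a_d = d\}. \] For $1 \leq i \leq d$, $\boldsymbol{e}_i \in \mathbb{Z}^d$ denotes the $i$-th canonical basis vector, i.e. the vector with $i$-th coordinate $1$ and all other coordinates $0$. *)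

theory Defs
  imports "HOL-Analysis.Analysis"
begin

text \<open>
  The paper's positive integer \<open>d\<close> is the cardinality of the index type \<open>'d\<close>: elements of
  \<open>\<int>\<^sup>d\<close> are vectors of type \<open>int ^ 'd\<close>, and \<open>d \<ge> 1\<close> because types are nonempty.
\<close>

definition H :: "(int ^ 'd) set" where
  "H = {a. (\<forall>i. a $ i \<ge> 0) \<and> (\<Sum>i\<in>UNIV. a $ i) = int CARD('d)}"

end

theory Submission imports Defs begin

text \<open>
  Subtracting the affine interpolation of the vertex values preserves midpoint convexity, so it
  suffices that a midpoint convex function \<open>g\<close> on \<open>H\<close> attains its maximum at a vertex. Among the
  maximisers of \<open>g\<close> take \<open>w\<close> with \<open>\<Sum>k. w\<^sub>k\<^sup>2\<close> maximal. If \<open>w\<^sub>i, w\<^sub>j \<ge> 1\<close> for some \<open>i \<noteq> j\<close>, then \<open>w\<close> is the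
  midpoint of \<open>w + (e\<^sub>i - e\<^sub>j)\<close> and \<open>w - (e\<^sub>i - e\<^sub>j)\<close>, which lie in \<open>H\<close> and are hence maximisers
  as well, but the strictly convex sum of squares is larger at one of them.
\<close>

lemma finite_H: "finite (H :: (int ^ 'd) set)"
proof (rule finite_subset)
  show "H \<subseteq> vec_lambda ` ((UNIV :: 'd set) \<rightarrow>\<^sub>E {0..int CARD('d)})"
  proof
    fix a :: "int ^ 'd" assume a: "a \<in> H"
    have "a $ i \<le> int CARD('d)" for i
      using a member_le_sum[of i UNIV "\<lambda>i. a $ i"] by (simp add: H_def)
    with a have "vec_nth a \<in> UNIV \<rightarrow>\<^sub>E {0..int CARD('d)}"
      by (auto simp: H_def)
    then show "a \<in> vec_lambda ` ((UNIV :: 'd set) \<rightarrow>\<^sub>E {0..int CARD('d)})"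
      by (metis image_eqI vec_nth_inverse)
  qed
  show "finite (vec_lambda ` ((UNIV :: 'd set) \<rightarrow>\<^sub>E {0..int CARD('d)}))"
    by (intro finite_imageI finite_PiE) auto
qed

lemma H_vertexI:
  fixes w :: "int ^ 'd"
  assumes w: "w \<in> H" and uniq: "\<And>i j. i \<noteq> j \<Longrightarrow> w $ i = 0 \<or> w $ j = 0"
  obtains i where "w = int CARD('d) *s axis i 1"
proof -
  have sum: "(\<Sum>k\<in>UNIV. w $ k) = int CARD('d)"
    using w by (simp add: H_def)
  \<comment> \<open>The coordinates cannot all vanish, since their sum \<open>CARD('d)\<close> is
    positive.\<close>
  then obtain i where i: "w $ i \<noteq> 0"
    by (metis of_nat_eq_0_iff sum.neutral zero_less_card_finite less_irrefl)
  have other: "w $ k = 0" if "k \<noteq> i" for k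
    using uniq[OF that] i by simp
  have "(\<Sum>k\<in>UNIV. w $ k) = (\<Sum>k\<in>{i}. w $ k)"
    by (rule sum.mono_neutral_right) (auto simp: other)
  with sum have "w = int CARD('d) *s axis i 1"
    by (auto simp: vec_eq_iff axis_def other)
  then show thesis by (rule that)
qed

lemma midpoint_convex_max_at_vertex:
  fixes g :: "int ^ 'd \<Rightarrow> real"
  assumes midpoint: "\<And>u v w. u \<in> H \<Longrightarrow> v \<in> H \<Longrightarrow> w \<in> H \<Longrightarrow> u + v = 2 *s w
      \<Longrightarrow> g w \<le> (g u + g v) / 2"
    and u: "u \<in> H"
  shows "\<exists>i. g u \<le> g (int CARD('d) *s axis i 1)"
proof -
  define q :: "int ^ 'd \<Rightarrow> int" where "q a = (\<Sum>k\<in>UNIV. (a $ k)\<^sup>2)" for a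
  define S where "S = {a \<in> H. g a = Max (g ` H)}"
  have le_Max: "g a \<le> Max (g ` H)" if "a \<in> H" for a
    using that by (simp add: finite_H)
  have "Max (g ` H) \<in> g ` H"
    using u by (intro Max_in) (auto simp: finite_H)
  then have "S \<noteq> {}" "finite S"
    by (auto simp: S_def finite_H)
  then obtain w where w: "w \<in> S" and q_max: "\<And>a. a \<in> S \<Longrightarrow> q a \<le> q w"
    using Max_in[of "q ` S"] Max_ge[of "q ` S"] by fastforce
  have wH: "w \<in> H" and gw: "g w = Max (g ` H)"
    using w by (auto simp: S_def)
  have "w $ i = 0 \<or> w $ j = 0" if ij: "i \<noteq> j" for i j
  proof (rule ccontr)
    assume nz: "\<not> (w $ i = 0 \<or> w $ j = 0)"
    have pos: "w $ k \<ge> 0" for k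
      using wH by (simp add: H_def)
    have "w $ i \<ge> 1" "w $ j \<ge> 1"
      using nz pos[of i] pos[of j] by auto
    define x :: "int ^ 'd" where "x = axis i 1 - axis j 1"
    have sum_x: "(\<Sum>k\<in>UNIV. x $ k) = 0"
      by (simp add: x_def axis_def sum_subtractf)
    \<comment> \<open>Each of the two shifts lowers a single coordinate, \<open>j\<close> or
      \<open>i\<close>, by 1, and that coordinate is at least 1; \<open>sum_x\<close> keeps the
      total unchanged.\<close>
    have "w + x \<in> H" "w - x \<in> H"
      using wH \<open>w $ i \<ge> 1\<close> \<open>w $ j \<ge> 1\<close> ij sum_x
      by (auto simp: H_def sum.distrib sum_subtractf) (auto simp: x_def axis_def)
    moreover have "(w + x) + (w - x) = 2 *s w"
      by (simp add: vec_eq_iff)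
    ultimately have "g w \<le> (g (w + x) + g (w - x)) / 2"
      using midpoint wH by blast
    \<comment> \<open>The maximum is bounded by the average of two values that do not exceed it, so
      both of them equal it.\<close>
    with le_Max[OF \<open>w + x \<in> H\<close>] le_Max[OF \<open>w - x \<in> H\<close>] gw
    have "w + x \<in> S" "w - x \<in> S"
      using \<open>w + x \<in> H\<close> \<open>w - x \<in> H\<close> by (auto simp: S_def)
    then have "q (w + x) + q (w - x) \<le> 2 * q w"
      using q_max[of "w + x"] q_max[of "w - x"] by simp
    \<comment> \<open>This is the parallelogram law; any positive lower bound on \<open>q x\<close>
      now gives a contradiction, and the coordinate \<open>i\<close> alone supplies 1.\<close>
    moreover have "q (w + x) + q (w - x) = 2 * q w + 2 * q x"
    proof -
      have "q (w + x) + q (w - x) = (\<Sum>k\<in>UNIV. (w $ k + x $ k)\<^sup>2 + (w $ k - x $ k)\<^sup>2)"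
        by (simp add: q_def sum.distrib)
      also have "\<dots> = (\<Sum>k\<in>UNIV. 2 * (w $ k)\<^sup>2 + 2 * (x $ k)\<^sup>2)"
        by (intro sum.cong) (auto simp: power2_eq_square algebra_simps)
      also have "\<dots> = 2 * q w + 2 * q x"
        unfolding q_def sum_distrib_left by (rule sum.distrib)
      finally show ?thesis .
    qed
    moreover have "(x $ i)\<^sup>2 \<le> q x"
      unfolding q_def by (rule member_le_sum) auto
    moreover have "x $ i = 1"
      using ij by (simp add: x_def axis_def)
    ultimately show False by simp
  qed
  then obtain i where "w = int CARD('d) *s axis i 1"
    by (rule H_vertexI[OF wH])
  with le_Max[OF u] gw show ?thesis by metis
qed

theorem proposition1p3:
  fixes f :: "int ^ 'd \<Rightarrow> real"
  assumes nonneg: "\<And>u. u \<in> H \<Longrightarrow> f u \<ge> 0"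
    and midpoint: "\<And>u v w. u \<in> H \<Longrightarrow> v \<in> H \<Longrightarrow> w \<in> H \<Longrightarrow> u + v = 2 *s w
      \<Longrightarrow> f w \<le> (f u + f v) / 2"
    and u: "u \<in> H"
  shows "f u \<le> 1 / real CARD('d) *
    (\<Sum>i\<in>UNIV. real_of_int (u $ i) * f (int CARD('d) *s axis i 1))"
proof -
  \<comment> \<open>Being additive, \<open>L\<close> satisfies the midpoint condition with equality,
    so \<open>f - L\<close> inherits the inequality from \<open>f\<close>. Doubling replaces halving
    because the vectors are integral.\<close>
  define L :: "int ^ 'd \<Rightarrow> real" where
    "L a = 1 / real CARD('d) *
      (\<Sum>i\<in>UNIV. real_of_int (a $ i) * f (int CARD('d) *s axis i 1))" for a
  have L_add: "L (a + b) = L a + L b" for a b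
    by (simp add: L_def distrib_right sum.distrib add_divide_distrib)
  have L_double: "L (2 *s a) = 2 * L a" for a
    by (simp add: L_def sum_distrib_left mult.assoc)
  have L_vertex: "L (int CARD('d) *s axis i 1) = f (int CARD('d) *s axis i 1)" for i
  proof -
    \<comment> \<open>Only the term \<open>k = i\<close> survives, and its factor
      \<open>CARD('d)\<close> cancels the normalisation in \<open>L\<close>.\<close>
    have "(\<Sum>k\<in>UNIV. real_of_int ((int CARD('d) *s axis i 1 :: int ^ 'd) $ k)
        * f (int CARD('d) *s axis k 1))
      = (\<Sum>k\<in>{i}. real CARD('d) * f (int CARD('d) *s axis k 1))"
      by (rule sum.mono_neutral_cong_right) (auto simp: axis_def)
    then show ?thesis by (simp add: L_def)
  qed
  have "\<exists>i. f u - L u \<le> f (int CARD('d) *s axis i 1) - L (int CARD('d) *s axis i 1)"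
  proof (rule midpoint_convex_max_at_vertex[OF _ u])
    fix a b w :: "int ^ 'd"
    assume "a \<in> H" "b \<in> H" "w \<in> H" and mid: "a + b = 2 *s w"
    then have "f w \<le> (f a + f b) / 2" by (rule midpoint)
    moreover have "L a + L b = 2 * L w"
      by (metis L_add L_double mid)
    ultimately show "f w - L w \<le> ((f a - L a) + (f b - L b)) / 2" by (simp add: field_simps)
  qed
  \<comment> \<open>At every vertex the difference \<open>f - L\<close> is 0, so its bound at
    \<open>u\<close> is 0.\<close>
  then have "f u \<le> L u" by (simp add: L_vertex)
  then show ?thesis by (simp add: L_def)
qed

end
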